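(* Assume that the Overshoot Hypothesis (stated in the context) holds, and let $g(\beta)$ and $T_* = T_*(\beta,w_0) > 0$ be as described there. Then for $\beta \ge 1$ the solution $z(t;\beta,w_0)$ of $$\frac{dz}{dt}(t) = w_0\,\frac{(z(t))^2}{(z(t-1))^\beta} \quad (t > 1), \qquad z(t) = \frac{1}{1 - w_0 t} \quad (0 \le t \le 1)$$ satisfies the following properties. (i) For $w_0 \in (g(\beta),1)$: $z(t;\beta,w_0) < \infty$ for $0 \le t < T_*$, and $z(t;\beta,w_0) \to \infty$ as $t \to T_*^-$. (ii) For $w_0 \in (0,g(\beta)]$: $z(t;\beta,w_0) < \infty$ for all $t \ge 0$, and $z(t;\beta,w_0) \to \infty$ as $t \to \infty$. (iii) The following comparison properties hold. If $0 < w_0 < \tilde{w}_0 < 1$, then $z(t;\beta,w_0) < z(t;\beta,\tilde{w}_0)$ for all $t > 0$. If $1 \le \beta < \tilde{\beta}$, then $z(t;\beta,g(\beta)) < z(t;\tilde{\beta},g(\tilde{\beta}))$ for all $t > 0$.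
   Context: For $\beta \ge 1$ and $w_0 \in (0,1)$, $u(t;\beta,w_0)$ denotes the unique function $u \in C^1([0,\infty))$ satisfying $$\frac{du}{dt}(t) = w_0\,|1 - u(t-1)|^\beta \quad (t > 1), \qquad u(t) = w_0 t \quad (0 \le t \le 1).$$ Overshoot Hypothesis (a conjecture in the paper, here used as a hypothesis): for each $\beta \ge 1$ there exists a unique value $g(\beta) \in (0,1)$ such that the following behavior holds. (i) If $w_0 \in (g(\beta),1)$, there exists a constant $T_* = T_*(\beta,w_0) > 0$ such that $u(t;\beta,w_0) < 1$ for $0 \le t < T_*$, $u(T_*;\beta,w_0) = 1$, and $u(t;\beta,w_0) > 1$ for $t > T_*$. (ii) If $w_0 \in (0,g(\beta)]$, then $u(t;\beta,w_0) < 1$ for all $t \ge 0$ and $u(t;\beta,w_0) \to 1$ as $t \to \infty$. (iii) Comparison properties: if $0 < w_0 < \tilde{w}_0 < 1$, then $u(t;\beta,w_0) < u(t;\beta,\tilde{w}_0)$ for all $t > 0$; and if $1 \le \beta < \tilde{\beta}$, then $u(t;\beta,g(\beta)) < u(t;\tilde{\beta},g(\tilde{\beta}))$ for all $t > 0$. The equation for $z$ is obtained from that for $u$ by the change of variable $z = \frac{1}{1-u}$.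
   Formalization: In (iii), the first comparison is stated for those t > 0 at which at least one of the two solutions is finite (a solution counts as ∞ from its blow-up time on), since for w_0 > g(β) and t ≥ T_*(β,w_0) both have blown up and a strict inequality has no meaning. *)

theory Defs
  imports "HOL-Analysis.Analysis"
begin

text \<open>One-sided derivatives are used at endpoints belonging to \<open>S\<close>.\<close>

definition C1_on :: "real set \<Rightarrow> (real \<Rightarrow> real) \<Rightarrow> bool" where
  "C1_on S f \<longleftrightarrow>
     (\<exists>f'. continuous_on S f' \<and> (\<forall>t\<in>S. (f has_real_derivative f' t) (at t within S)))"

definition is_u_solution :: "real \<Rightarrow> real \<Rightarrow> (real \<Rightarrow> real) \<Rightarrow> bool" where
  "is_u_solution \<beta> w\<^sub>0 u \<longleftrightarrow>
     C1_on {0..} u \<and>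
     (\<forall>t. 0 \<le> t \<and> t \<le> 1 \<longrightarrow> u t = w\<^sub>0 * t) \<and>
     (\<forall>t>1. (u has_real_derivative w\<^sub>0 * \<bar>1 - u (t - 1)\<bar> powr \<beta>) (at t))"

text \<open>A solution lives on \<open>[0,\<infinity>)\<close> only; the (irrelevant) values at negative times are set to \<open>0\<close>
  so that the solution is unique as a total function.\<close>

definition u_sol :: "real \<Rightarrow> real \<Rightarrow> real \<Rightarrow> real" where
  "u_sol \<beta> w\<^sub>0 = (THE u. is_u_solution \<beta> w\<^sub>0 u \<and> (\<forall>t<0. u t = 0))"

definition crosses_one_at :: "(real \<Rightarrow> real) \<Rightarrow> real \<Rightarrow> bool" where
  "crosses_one_at u T \<longleftrightarrow>
     T > 0 \<and> (\<forall>t. 0 \<le> t \<and> t < T \<longrightarrow> u t < 1) \<and> u T = 1 \<and> (\<forall>t>T. u t > 1)"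

definition T_star :: "real \<Rightarrow> real \<Rightarrow> real" where
  "T_star \<beta> w\<^sub>0 = (THE T. crosses_one_at (u_sol \<beta> w\<^sub>0) T)"

definition is_threshold :: "real \<Rightarrow> real \<Rightarrow> bool" where
  "is_threshold \<beta> \<gamma> \<longleftrightarrow>
     0 < \<gamma> \<and> \<gamma> < 1 \<and>
     (\<forall>w\<^sub>0. \<gamma> < w\<^sub>0 \<and> w\<^sub>0 < 1 \<longrightarrow> (\<exists>T. crosses_one_at (u_sol \<beta> w\<^sub>0) T)) \<and>
     (\<forall>w\<^sub>0. 0 < w\<^sub>0 \<and> w\<^sub>0 \<le> \<gamma> \<longrightarrow>
        (\<forall>t\<ge>0. u_sol \<beta> w\<^sub>0 t < 1) \<and> (u_sol \<beta> w\<^sub>0 \<longlongrightarrow> 1) at_top)"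

definition g :: "real \<Rightarrow> real" where
  "g \<beta> = (THE \<gamma>. is_threshold \<beta> \<gamma>)"

text \<open>The second comparison property relates thresholds for different exponents, so it is
  a condition on the whole function \<open>g\<close> and not part of what singles out one value \<open>g \<beta>\<close>.\<close>

definition Overshoot_Hypothesis :: bool where
  "Overshoot_Hypothesis \<longleftrightarrow>
     (\<forall>\<beta>\<ge>1. \<exists>!\<gamma>. is_threshold \<beta> \<gamma>) \<and>
     (\<forall>\<beta> w\<^sub>0 w\<^sub>1. 1 \<le> \<beta> \<and> 0 < w\<^sub>0 \<and> w\<^sub>0 < w\<^sub>1 \<and> w\<^sub>1 < 1 \<longrightarrow>
        (\<forall>t>0. u_sol \<beta> w\<^sub>0 t < u_sol \<beta> w\<^sub>1 t)) \<and>
     (\<forall>\<beta> \<beta>'. 1 \<le> \<beta> \<and> \<beta> < \<beta>' \<longrightarrow>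
        (\<forall>t>0. u_sol \<beta> (g \<beta>) t < u_sol \<beta>' (g \<beta>') t))"

text \<open>The \<open>z\<close>-equation may blow up in finite time, hence solutions on \<open>[0,T)\<close>.\<close>

definition is_z_solution :: "real \<Rightarrow> real \<Rightarrow> real \<Rightarrow> (real \<Rightarrow> real) \<Rightarrow> bool" where
  "is_z_solution \<beta> w\<^sub>0 T z \<longleftrightarrow>
     C1_on {0..<T} z \<and>
     (\<forall>t. 0 \<le> t \<and> t \<le> 1 \<and> t < T \<longrightarrow> z t = 1 / (1 - w\<^sub>0 * t)) \<and>
     (\<forall>t. 1 < t \<and> t < T \<longrightarrow>
        (z has_real_derivative w\<^sub>0 * (z t)\<^sup>2 / (z (t - 1)) powr \<beta>) (at t))"

text \<open>The maximally continued solution, with value \<open>\<infinity>\<close> at times \<open>t \<ge> 0\<close> that no solution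
  reaches; thus \<open>z_sol \<beta> w\<^sub>0 t < \<infinity>\<close> says that the solution exists up to and including time \<open>t\<close>.
  Once two solutions have both blown up, both values are \<open>\<infinity>\<close>, so a strict comparison is meaningful
  only at times at which at least one of them is finite.\<close>

definition z_sol :: "real \<Rightarrow> real \<Rightarrow> real \<Rightarrow> ereal" where
  "z_sol \<beta> w\<^sub>0 t =
     (if \<exists>T z. t < T \<and> is_z_solution \<beta> w\<^sub>0 T z
      then ereal (THE y. \<exists>T z. t < T \<and> is_z_solution \<beta> w\<^sub>0 T z \<and> y = z t)
      else \<infinity>)"

end

theory Submission
  imports Defs
begin

text \<open>
  With \<open>z = 1 / (1 - u)\<close> one has \<open>z' = u' z\<^sup>2\<close> and \<open>1 - u (t - 1) = 1 / z (t - 1)\<close>, so the two delay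
  equations are the same as long as \<open>u < 1\<close>. The theorem is therefore a translation of the Overshoot
  Hypothesis, once it is known what \<open>u_sol\<close> and \<open>z_sol\<close> really are; both are
  defined through uniqueness, so this requires well-posedness of the two equations.

  For \<open>u\<close>, extending by \<open>0\<close> to negative times turns the initial condition \<open>u t = w t\<close> on \<open>[0,1]\<close> into
  an instance of the equation itself, since there \<open>\<bar>1 - u (t - 1)\<bar> = 1\<close>. Thus \<open>u\<close> is the fixed point
  of one integral operator, reached in finitely many iterations on each bounded interval because of
  the delay (\<open>delay_step_fixpoint\<close>). Uniqueness holds on every \<open>[0,T)\<close>
  by stepping through unit intervals (\<open>delay_ivp_unique\<close>).

  For \<open>z\<close>, the right-hand side of the equation is nonnegative, so every solution satisfies \<open>z \<ge> 1\<close>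
  and \<open>1 - 1 / z\<close> is a solution of the \<open>u\<close>-equation with values below \<open>1\<close>. By uniqueness
  \<open>z = 1 / (1 - u)\<close>, and, \<open>u\<close> being nondecreasing, the solution exists up to time \<open>t\<close> exactly
  when \<open>u t < 1\<close> (\<open>z_sol_eq\<close>). Blow-up of \<open>z\<close> is then \<open>u \<longrightarrow> 1\<close> from below, and \<open>x \<mapsto> 1 / (1 - x)\<close>
  is strictly increasing below \<open>1\<close>, which carries over the comparison properties.
\<close>

section \<open>Well-posedness of the equation for \<open>u\<close>\<close>

lemma integral_from_0_has_derivative:
  fixes h :: "real \<Rightarrow> real"
  assumes "continuous_on UNIV h" and "0 \<le> t"
  shows "((\<lambda>t. integral {0..t} h) has_real_derivative h t) (at t within {0..})"
proof -
  have "((\<lambda>t. integral {0..t} h) has_real_derivative h t) (at t within {0..t+1})"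
    using assms by (intro integral_has_real_derivative) (auto intro: continuous_on_subset)
  moreover have "at t within {0..t+1} = at t within {0..}"
    by (rule at_within_nhd[where S = "{..<t+1}"]) auto
  ultimately show ?thesis by simp
qed

lemma continuous_integral_from_0:
  fixes h :: "real \<Rightarrow> real"
  assumes "continuous_on UNIV h"
  shows "continuous_on UNIV (\<lambda>t. integral {0..t} h)"
proof -
  have "continuous_on {0..} (\<lambda>t. integral {0..t} h)"
    by (rule DERIV_continuous_on) (use integral_from_0_has_derivative[OF assms] in auto)
  then have "continuous_on UNIV (\<lambda>t. integral {0..max 0 t} h)"
    by (rule continuous_on_compose2) (auto intro!: continuous_intros)
  moreover have "integral {0..max 0 t} h = integral {0..t} h" for t
    by (cases "t \<le> 0") (cases "t = 0"; simp)+
  ultimately show ?thesis by simp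
qed

definition delay_step :: "real \<Rightarrow> real \<Rightarrow> (real \<Rightarrow> real) \<Rightarrow> real \<Rightarrow> real" where
  "delay_step \<beta> w u t = integral {0..t} (\<lambda>s. w * \<bar>1 - u (s - 1)\<bar> powr \<beta>)"

lemma continuous_delay_rhs:
  fixes u :: "real \<Rightarrow> real"
  assumes "continuous_on UNIV u" and "0 < \<beta>"
  shows "continuous_on UNIV (\<lambda>s. w * \<bar>1 - u (s - 1)\<bar> powr \<beta>)"
proof -
  have "continuous_on UNIV (\<lambda>s::real. u (s - 1))"
    by (rule continuous_on_compose2[OF assms(1)]) (auto intro!: continuous_intros)
  then show ?thesis
    using \<open>0 < \<beta>\<close> by (intro continuous_intros continuous_on_powr') auto
qed

text \<open>Since \<open>delay_step \<beta> w u\<close> at time \<open>t\<close> only sees \<open>u\<close> up to \<open>t - 1\<close>, the \<open>n\<close>-th iterate started from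
  \<open>0\<close> is already final on \<open>{..n}\<close>; the fixed point is obtained by gluing these pieces.\<close>

lemma delay_step_fixpoint:
  assumes "0 < \<beta>"
  obtains u where "continuous_on UNIV u" and "u = delay_step \<beta> w u"
proof -
  define S where "S n = (delay_step \<beta> w ^^ n) (\<lambda>_. 0)" for n
  have S_Suc: "S (Suc n) = delay_step \<beta> w (S n)" for n
    by (simp add: S_def)
  have cont: "continuous_on UNIV (S n)" for n
  proof (induction n)
    case 0
    then show ?case by (simp add: S_def)
  next
    case (Suc n)
    then show ?case
      unfolding S_Suc delay_step_def
      by (intro continuous_integral_from_0 continuous_delay_rhs assms)
  qed
  have step_cong: "delay_step \<beta> w v t = delay_step \<beta> w v' t"
    if "\<And>s. s \<le> t - 1 \<Longrightarrow> v s = v' s" for v v' t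
    unfolding delay_step_def by (rule integral_cong) (use that in auto)
  have step_neg: "delay_step \<beta> w v t = 0" if "t \<le> 0" for v t
    using that unfolding delay_step_def by (cases "t = 0") auto
  have stable1: "S (Suc n) t = S n t" if "t \<le> real n" for n t
    using that
  proof (induction n arbitrary: t)
    case 0
    then show ?case by (simp add: S_Suc step_neg) (simp add: S_def)
  next
    case (Suc n)
    show ?case
      unfolding S_Suc[of "Suc n"] S_Suc[of n]
      by (rule step_cong) (use Suc in \<open>auto simp flip: S_Suc\<close>)
  qed
  have stable: "S m t = S n t" if "n \<le> m" "t \<le> real n" for m n t
    using that by (induction m rule: dec_induct) (auto simp: stable1)
  define u where "u t = S (nat \<lceil>t\<rceil>) t" for t
  have u_eq: "u t = S n t" if "t \<le> real n" for n t
    unfolding u_def using that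
    by (intro stable[symmetric]) (auto simp: real_nat_ceiling_ge ceiling_le_iff nat_le_iff)
  show ?thesis
  proof (rule that)
    show "continuous_on UNIV u"
    proof (rule continuous_at_imp_continuous_on, intro ballI)
      fix t :: real
      obtain n where n: "t < real n"
        using reals_Archimedean2 by blast
      have "isCont (S n) t"
        using cont by (simp add: continuous_on_eq_continuous_at)
      moreover have "\<forall>\<^sub>F s in nhds t. S n s = u s"
        using eventually_nhds_in_open[of "{..<real n}" t] n
        by (auto elim!: eventually_mono simp: u_eq[OF less_imp_le])
      ultimately show "isCont u t"
        using isCont_cong by blast
    qed
    show "u = delay_step \<beta> w u"
    proof
      fix t :: real
      obtain n where n: "t < real n"
        using reals_Archimedean2 by blast
      have "u t = S (Suc n) t"
        using n by (intro u_eq) auto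
      also have "\<dots> = delay_step \<beta> w u t"
        unfolding S_Suc by (rule step_cong) (use n in \<open>simp add: u_eq[of _ n]\<close>)
      finally show "u t = delay_step \<beta> w u t" .
    qed
  qed
qed

text \<open>What a solution on \<open>[0,T)\<close> has to satisfy for uniqueness; \<open>1 - 1 / z\<close> will be of this form.\<close>

definition delay_ivp :: "real \<Rightarrow> real \<Rightarrow> real \<Rightarrow> (real \<Rightarrow> real) \<Rightarrow> bool" where
  "delay_ivp \<beta> w T u \<longleftrightarrow>
     continuous_on {0..<T} u \<and>
     (\<forall>t. 0 \<le> t \<and> t \<le> 1 \<and> t < T \<longrightarrow> u t = w * t) \<and>
     (\<forall>t. 1 < t \<and> t < T \<longrightarrow>
        (u has_real_derivative w * \<bar>1 - u (t - 1)\<bar> powr \<beta>) (at t))"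

text \<open>Once two solutions agree up to time \<open>n\<close>, they have the same derivative up to time \<open>n + 1\<close>.\<close>

lemma delay_ivp_unique:
  assumes u: "delay_ivp \<beta> w T u" and v: "delay_ivp \<beta> w T v"
    and t: "0 \<le> t" "t < T"
  shows "u t = v t"
proof -
  have "\<forall>t. 0 \<le> t \<and> t < T \<and> t \<le> 1 + real n \<longrightarrow> u t = v t" for n
  proof (induction n)
    case 0
    then show ?case using u v by (auto simp: delay_ivp_def)
  next
    case (Suc n)
    show ?case
    proof (intro allI impI, elim conjE)
      fix t assume t: "0 \<le> t" "t < T" "t \<le> 1 + real (Suc n)"
      show "u t = v t"
      proof (cases "t \<le> 1")
        case True
        then show ?thesis using u v t by (auto simp: delay_ivp_def)
      next
        case False
        have "u t - v t = u 1 - v 1"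
        proof (rule DERIV_isconst_end[where f = "\<lambda>t. u t - v t"])
          show "1 < t" using False by simp
          have "continuous_on {0..<T} (\<lambda>t. u t - v t)"
            using u v by (auto simp: delay_ivp_def intro!: continuous_intros)
          then show "continuous_on {1..t} (\<lambda>t. u t - v t)"
            by (rule continuous_on_subset) (use t in auto)
          fix x assume x: "1 < x" "x < t"
          have "u (x - 1) = v (x - 1)" using Suc x t by simp
          moreover have "((\<lambda>t. u t - v t) has_real_derivative
              w * \<bar>1 - u (x - 1)\<bar> powr \<beta> - w * \<bar>1 - v (x - 1)\<bar> powr \<beta>) (at x)"
            using u v x t by (intro DERIV_diff) (auto simp: delay_ivp_def)
          ultimately show "((\<lambda>t. u t - v t) has_real_derivative 0) (at x)" by simp
        qed
        moreover have "u 1 = v 1"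
          using u v t False by (auto simp: delay_ivp_def)
        ultimately show ?thesis by simp
      qed
    qed
  qed
  moreover obtain n where "t \<le> real n"
    using real_arch_simple by blast
  ultimately show ?thesis using t by (metis add_increasing zero_le_one)
qed

lemma is_u_solution_imp_delay_ivp:
  assumes "is_u_solution \<beta> w u"
  shows "delay_ivp \<beta> w T u"
proof -
  have "continuous_on {0..} u"
    using assms by (auto simp: is_u_solution_def C1_on_def intro: DERIV_continuous_on)
  then have "continuous_on {0..<T} u"
    by (rule continuous_on_subset) auto
  then show ?thesis using assms by (auto simp: is_u_solution_def delay_ivp_def)
qed

text \<open>In contrast to the defining property, the delay equation here holds from time \<open>0\<close> on, by the
  zero history. This covers the junction at \<open>t = 1\<close> and gives continuous differentiability.\<close>

lemma u_sol_properties: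
  assumes "0 < \<beta>"
  shows "is_u_solution \<beta> w (u_sol \<beta> w)"
    and "0 \<le> t \<Longrightarrow> (u_sol \<beta> w has_real_derivative w * \<bar>1 - u_sol \<beta> w (t - 1)\<bar> powr \<beta>)
           (at t within {0..})"
proof -
  obtain u where cont: "continuous_on UNIV u" and fix_u: "u = delay_step \<beta> w u"
    using delay_step_fixpoint[OF assms] by blast
  let ?h = "\<lambda>s. w * \<bar>1 - u (s - 1)\<bar> powr \<beta>"
  have cont_h: "continuous_on UNIV ?h"
    by (rule continuous_delay_rhs[OF cont assms])
  have u_int: "u t = integral {0..t} ?h" for t
    using fun_cong[OF fix_u, of t] by (simp add: delay_step_def)
  have u_nonpos: "u t = 0" if "t \<le> 0" for t
    using that u_int[of t] by (cases "t = 0") auto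
  have deriv: "(u has_real_derivative ?h t) (at t within {0..})" if "0 \<le> t" for t
    using integral_from_0_has_derivative[OF cont_h that] unfolding u_int[symmetric] by simp
  have u_lin: "u t = w * t" if "0 \<le> t" "t \<le> 1" for t
  proof -
    have "u t = integral {0..t} (\<lambda>_. w)"
      unfolding u_int[of t] by (rule integral_cong) (use that u_nonpos in auto)
    then show ?thesis using that by simp
  qed
  have sol: "is_u_solution \<beta> w u"
    unfolding is_u_solution_def C1_on_def
  proof (intro conjI allI impI)
    show "\<exists>f'. continuous_on {0..} f' \<and>
        (\<forall>t\<in>{0..}. (u has_real_derivative f' t) (at t within {0..}))"
      using deriv continuous_on_subset[OF cont_h] by (intro exI[of _ ?h]) auto
    show "(u has_real_derivative ?h t) (at t)" if "1 < t" for t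
    proof -
      have "at t within {0..} = at t"
        using that by (intro at_within_interior) auto
      then show ?thesis using deriv[of t] that by simp
    qed
  qed (use u_lin in auto)
  have "u_sol \<beta> w = u"
    unfolding u_sol_def
  proof (rule the_equality)
    show "is_u_solution \<beta> w u \<and> (\<forall>t<0. u t = 0)"
      using sol u_nonpos by auto
    fix v assume v: "is_u_solution \<beta> w v \<and> (\<forall>t<0. v t = 0)"
    show "v = u"
    proof
      fix t :: real
      show "v t = u t"
      proof (cases "t < 0")
        case True
        then show ?thesis using v u_nonpos by simp
      next
        case False
        then show ?thesis
          using v sol
          by (intro delay_ivp_unique[of \<beta> w "t + 1"] is_u_solution_imp_delay_ivp) auto
      qed
    qed
  qed
  then show "is_u_solution \<beta> w (u_sol \<beta> w)"
    and "0 \<le> t \<Longrightarrow> (u_sol \<beta> w has_real_derivative w * \<bar>1 - u_sol \<beta> w (t - 1)\<bar> powr \<beta>)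
           (at t within {0..})"
    using sol deriv by auto
qed

lemma continuous_on_u_sol:
  assumes "0 < \<beta>"
  shows "continuous_on {0..} (u_sol \<beta> w)"
  using u_sol_properties(2)[OF assms] by (intro DERIV_continuous_on) auto

lemma u_sol_mono:
  assumes "0 < \<beta>" and "0 \<le> w" and "0 \<le> s" and "s \<le> t"
  shows "u_sol \<beta> w s \<le> u_sol \<beta> w t"
proof (rule DERIV_nonneg_imp_increasing_open[OF \<open>s \<le> t\<close>])
  show "continuous_on {s..t} (u_sol \<beta> w)"
    by (rule continuous_on_subset[OF continuous_on_u_sol]) (use assms in auto)
  fix x assume x: "s < x" "x < t"
  then have "at x within {0..} = at x"
    using assms by (intro at_within_interior) auto
  then have "(u_sol \<beta> w has_real_derivative w * \<bar>1 - u_sol \<beta> w (x - 1)\<bar> powr \<beta>) (at x)"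
    using u_sol_properties(2)[OF \<open>0 < \<beta>\<close>, of x w] x assms by simp
  moreover have "0 \<le> w * \<bar>1 - u_sol \<beta> w (x - 1)\<bar> powr \<beta>"
    using \<open>0 \<le> w\<close> by simp
  ultimately show "\<exists>y. (u_sol \<beta> w has_real_derivative y) (at x) \<and> 0 \<le> y"
    by blast
qed

section \<open>The change of variable \<open>z = 1 / (1 - u)\<close>\<close>

text \<open>The right-hand side of the \<open>z\<close>-equation is nonnegative before anything is known about the
  sign of \<open>z\<close>, because \<open>powr\<close> takes only nonnegative values and division by \<open>0\<close> gives \<open>0\<close>. So \<open>z\<close>
  increases from \<open>z 0 = 1\<close>.\<close>

lemma is_z_solution_ge_1:
  assumes z: "is_z_solution \<beta> w T z" and w: "0 < w" "w < 1" and t: "0 \<le> t" "t < T"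
  shows "1 \<le> z t"
proof -
  have init: "1 \<le> z s" if "0 \<le> s" "s \<le> 1" "s < T" for s
  proof -
    have "w * s < 1"
      using w that by (metis less_eq_real_def mult_left_le order_le_less_trans)
    moreover have "0 \<le> w * s"
      using w that by simp
    ultimately show ?thesis
      using z that by (auto simp: is_z_solution_def)
  qed
  show ?thesis
  proof (cases "t \<le> 1")
    case True
    then show ?thesis using init t by simp
  next
    case False
    have "z 1 \<le> z t"
    proof (rule DERIV_nonneg_imp_increasing_open[where f = z])
      show "1 \<le> t" using False by simp
      have "continuous_on {0..<T} z"
        using z by (auto simp: is_z_solution_def C1_on_def intro: DERIV_continuous_on)
      then show "continuous_on {1..t} z"
        by (rule continuous_on_subset) (use t in auto)
      fix x assume "1 < x" "x < t"
      then have "(z has_real_derivative w * (z x)\<^sup>2 / z (x - 1) powr \<beta>) (at x)"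
        using z t by (auto simp: is_z_solution_def)
      moreover have "0 \<le> w * (z x)\<^sup>2 / z (x - 1) powr \<beta>"
        using w by simp
      ultimately show "\<exists>y. (z has_real_derivative y) (at x) \<and> 0 \<le> y"
        by blast
    qed
    then show ?thesis using init[of 1] t False by simp
  qed
qed

lemma is_z_solution_imp_delay_ivp:
  assumes z: "is_z_solution \<beta> w T z" and w: "0 < w" "w < 1"
  shows "delay_ivp \<beta> w T (\<lambda>t. 1 - 1 / z t)"
  unfolding delay_ivp_def
proof (intro conjI allI impI)
  note ge_1 = is_z_solution_ge_1[OF z w]
  have "continuous_on {0..<T} z"
    using z by (auto simp: is_z_solution_def C1_on_def intro: DERIV_continuous_on)
  then show "continuous_on {0..<T} (\<lambda>t. 1 - 1 / z t)"
    using ge_1 by (intro continuous_intros) fastforce+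
  show "1 - 1 / z t = w * t" if "0 \<le> t \<and> t \<le> 1 \<and> t < T" for t
    using z that by (auto simp: is_z_solution_def)
  fix t assume t: "1 < t \<and> t < T"
  have z0: "1 \<le> z t" "1 \<le> z (t - 1)"
    using ge_1 t by auto
  have "(z has_real_derivative w * (z t)\<^sup>2 / z (t - 1) powr \<beta>) (at t)"
    using z t by (auto simp: is_z_solution_def)
  then have "((\<lambda>t. 1 - 1 / z t) has_real_derivative
      (w * (z t)\<^sup>2 / z (t - 1) powr \<beta>) / (z t)\<^sup>2) (at t)"
    using z0 by (auto intro!: derivative_eq_intros simp: power2_eq_square)
  moreover have "(w * (z t)\<^sup>2 / z (t - 1) powr \<beta>) / (z t)\<^sup>2 =
      w * \<bar>1 - (1 - 1 / z (t - 1))\<bar> powr \<beta>"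
    using z0 by (simp add: powr_divide)
  ultimately show "((\<lambda>t. 1 - 1 / z t) has_real_derivative
      w * \<bar>1 - (1 - 1 / z (t - 1))\<bar> powr \<beta>) (at t)" by simp
qed

lemma is_z_solution_unique:
  assumes "0 < \<beta>" and z: "is_z_solution \<beta> w T z" and w: "0 < w" "w < 1"
    and t: "0 \<le> t" "t < T"
  shows "u_sol \<beta> w t < 1" and "z t = 1 / (1 - u_sol \<beta> w t)"
proof -
  have "1 - 1 / z t = u_sol \<beta> w t"
    using delay_ivp_unique[OF is_z_solution_imp_delay_ivp[OF z w]
        is_u_solution_imp_delay_ivp[OF u_sol_properties(1)[OF \<open>0 < \<beta>\<close>]] t] .
  moreover have "1 \<le> z t"
    by (rule is_z_solution_ge_1[OF z w t])
  ultimately have u: "1 - u_sol \<beta> w t = 1 / z t" and pos: "0 < 1 / z t"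
    by auto
  show "u_sol \<beta> w t < 1"
    using pos unfolding u[symmetric] by simp
  show "z t = 1 / (1 - u_sol \<beta> w t)"
    unfolding u by simp
qed

lemma is_z_solution_of_u_sol:
  assumes "0 < \<beta>" and less_1: "\<And>s. 0 \<le> s \<Longrightarrow> s < T \<Longrightarrow> u_sol \<beta> w s < 1"
  shows "is_z_solution \<beta> w T (\<lambda>t. 1 / (1 - u_sol \<beta> w t))"
proof -
  let ?u = "u_sol \<beta> w"
  have u: "is_u_solution \<beta> w ?u"
    by (rule u_sol_properties(1)[OF \<open>0 < \<beta>\<close>])
  then obtain f where f: "continuous_on {0..} f"
    "\<And>t. 0 \<le> t \<Longrightarrow> (?u has_real_derivative f t) (at t within {0..})"
    by (auto simp: is_u_solution_def C1_on_def)
  have neq: "?u t \<noteq> 1" if "0 \<le> t" "t < T" for t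
    using less_1 that by fastforce
  show ?thesis
    unfolding is_z_solution_def C1_on_def
  proof (intro conjI allI impI exI ballI)
    have "continuous_on {0..<T} f" "continuous_on {0..<T} ?u"
      by (rule continuous_on_subset[OF f(1)]
          continuous_on_subset[OF continuous_on_u_sol[OF \<open>0 < \<beta>\<close>]]; auto)+
    then show "continuous_on {0..<T} (\<lambda>t. f t / (1 - ?u t)\<^sup>2)"
      using neq by (intro continuous_intros) force+
    show "((\<lambda>t. 1 / (1 - ?u t)) has_real_derivative f t / (1 - ?u t)\<^sup>2) (at t within {0..<T})"
      if "t \<in> {0..<T}" for t
    proof -
      have "(?u has_real_derivative f t) (at t within {0..<T})"
        by (rule has_field_derivative_subset[OF f(2)]) (use that in auto)
      then show ?thesis
        using neq[of t] that by (auto intro!: derivative_eq_intros simp: power2_eq_square)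
    qed
    show "1 / (1 - ?u t) = 1 / (1 - w * t)" if "0 \<le> t \<and> t \<le> 1 \<and> t < T" for t
      using u that by (auto simp: is_u_solution_def)
    fix t assume t: "1 < t \<and> t < T"
    have "(?u has_real_derivative w * \<bar>1 - ?u (t - 1)\<bar> powr \<beta>) (at t)"
      using u t by (auto simp: is_u_solution_def)
    then have "((\<lambda>t. 1 / (1 - ?u t)) has_real_derivative
        (w * \<bar>1 - ?u (t - 1)\<bar> powr \<beta>) / (1 - ?u t)\<^sup>2) (at t)"
      using neq[of t] t by (auto intro!: derivative_eq_intros simp: power2_eq_square)
    moreover have "(w * \<bar>1 - ?u (t - 1)\<bar> powr \<beta>) / (1 - ?u t)\<^sup>2 =
        w * (1 / (1 - ?u t))\<^sup>2 / (1 / (1 - ?u (t - 1))) powr \<beta>"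
      using less_1[of "t - 1"] t by (simp add: powr_divide power_divide)
    ultimately show "((\<lambda>t. 1 / (1 - ?u t)) has_real_derivative
        w * (1 / (1 - ?u t))\<^sup>2 / (1 / (1 - ?u (t - 1))) powr \<beta>) (at t)" by simp
  qed
qed

text \<open>A solution of the \<open>z\<close>-equation reaching \<open>t\<close> has to live on some \<open>[0,T)\<close> with \<open>T > t\<close>. If
  \<open>u t < 1\<close>, then \<open>u < 1\<close> persists slightly beyond \<open>t\<close> by continuity, and holds before \<open>t\<close> by
  monotonicity.\<close>

lemma z_sol_eq:
  assumes "0 < \<beta>" and w: "0 < w" "w < 1" and "0 \<le> t"
  shows "z_sol \<beta> w t =
    (if u_sol \<beta> w t < 1 then ereal (1 / (1 - u_sol \<beta> w t)) else \<infinity>)"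
proof (cases "u_sol \<beta> w t < 1")
  case True
  have "((u_sol \<beta> w) \<longlongrightarrow> u_sol \<beta> w t) (at t within {0..})"
    using continuous_on_u_sol[OF \<open>0 < \<beta>\<close>] \<open>0 \<le> t\<close> by (auto simp: continuous_on_def)
  then have "\<forall>\<^sub>F s in at t within {0..}. u_sol \<beta> w s < 1"
    using True by (rule order_tendstoD)
  then obtain d where d: "0 < d"
    "\<And>s. 0 \<le> s \<Longrightarrow> s \<noteq> t \<Longrightarrow> dist s t < d \<Longrightarrow> u_sol \<beta> w s < 1"
    unfolding eventually_at by auto
  have "u_sol \<beta> w s < 1" if "0 \<le> s" "s < t + d" for s
  proof (cases "s \<le> t")
    case True
    then have "u_sol \<beta> w s \<le> u_sol \<beta> w t"
      using assms that by (intro u_sol_mono) auto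
    then show ?thesis using \<open>u_sol \<beta> w t < 1\<close> by simp
  next
    case False
    then show ?thesis using d(2)[of s] that by (auto simp: dist_real_def)
  qed
  then have sol: "is_z_solution \<beta> w (t + d) (\<lambda>t. 1 / (1 - u_sol \<beta> w t))"
    by (intro is_z_solution_of_u_sol \<open>0 < \<beta>\<close>)
  have "t < t + d" using d(1) by simp
  then have "\<exists>T z. t < T \<and> is_z_solution \<beta> w T z"
    using sol by blast
  moreover have "(THE y. \<exists>T z. t < T \<and> is_z_solution \<beta> w T z \<and> y = z t) = 1 / (1 - u_sol \<beta> w t)"
  proof (rule the_equality)
    show "\<exists>T z. t < T \<and> is_z_solution \<beta> w T z \<and> 1 / (1 - u_sol \<beta> w t) = z t"
      using sol \<open>t < t + d\<close> by (intro exI conjI) auto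
  qed (use is_z_solution_unique(2)[OF \<open>0 < \<beta>\<close> _ w \<open>0 \<le> t\<close>] in auto)
  ultimately show ?thesis
    using True by (simp add: z_sol_def)
next
  case False
  then have "\<not> (\<exists>T z. t < T \<and> is_z_solution \<beta> w T z)"
    using is_z_solution_unique(1)[OF \<open>0 < \<beta>\<close> _ w \<open>0 \<le> t\<close>] by auto
  then show ?thesis
    using False by (simp add: z_sol_def)
qed

lemma z_sol_less_infinity_iff:
  assumes "0 < \<beta>" "0 < w" "w < 1" "0 \<le> t"
  shows "z_sol \<beta> w t < \<infinity> \<longleftrightarrow> u_sol \<beta> w t < 1"
  using z_sol_eq[OF assms] by auto

lemma z_sol_less:
  assumes "0 < \<beta>\<^sub>0" "0 < w\<^sub>0" "w\<^sub>0 < 1" and "0 < \<beta>\<^sub>1" "0 < w\<^sub>1" "w\<^sub>1 < 1" and "0 \<le> t"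
    and "u_sol \<beta>\<^sub>0 w\<^sub>0 t < u_sol \<beta>\<^sub>1 w\<^sub>1 t" and "u_sol \<beta>\<^sub>0 w\<^sub>0 t < 1"
  shows "z_sol \<beta>\<^sub>0 w\<^sub>0 t < z_sol \<beta>\<^sub>1 w\<^sub>1 t"
  using assms by (auto simp: z_sol_eq intro!: divide_strict_left_mono)

lemma z_sol_tendsto_infinity:
  assumes "0 < \<beta>" "0 < w" "w < 1" and lim: "(u_sol \<beta> w \<longlongrightarrow> 1) F"
    and ev: "\<forall>\<^sub>F t in F. 0 \<le> t \<and> u_sol \<beta> w t < 1"
  shows "(z_sol \<beta> w \<longlongrightarrow> \<infinity>) F"
proof -
  have "((\<lambda>t. 1 - u_sol \<beta> w t) \<longlongrightarrow> 0) F"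
    using tendsto_diff[OF tendsto_const lim, of 1] by simp
  then have "filterlim (\<lambda>t. inverse (1 - u_sol \<beta> w t)) at_top F"
    by (rule filterlim_inverse_at_top) (use ev in \<open>auto elim: eventually_mono\<close>)
  then have "((\<lambda>t. ereal (inverse (1 - u_sol \<beta> w t))) \<longlongrightarrow> \<infinity>) F"
    by (simp add: tendsto_PInfty_eq_at_top)
  moreover have "\<forall>\<^sub>F t in F. ereal (inverse (1 - u_sol \<beta> w t)) = z_sol \<beta> w t"
    using ev by (rule eventually_mono) (use assms in \<open>auto simp: z_sol_eq inverse_eq_divide\<close>)
  ultimately show ?thesis
    by (rule Lim_transform_eventually)
qed

section \<open>Consequences of the Overshoot Hypothesis\<close>

lemma is_threshold_g:
  assumes "Overshoot_Hypothesis" and "1 \<le> \<beta>"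
  shows "is_threshold \<beta> (g \<beta>)"
  unfolding g_def by (rule theI') (use assms in \<open>auto simp: Overshoot_Hypothesis_def\<close>)

lemma crosses_one_at_unique:
  assumes "crosses_one_at u S" and "crosses_one_at u T"
  shows "S = T"
  using assms unfolding crosses_one_at_def
  by (metis less_irrefl linorder_neqE_linordered_idom less_imp_le)

lemma crosses_one_at_T_star:
  assumes "is_threshold \<beta> \<gamma>" and "\<gamma> < w" and "w < 1"
  shows "crosses_one_at (u_sol \<beta> w) (T_star \<beta> w)"
proof -
  obtain T where "crosses_one_at (u_sol \<beta> w) T"
    using assms by (auto simp: is_threshold_def)
  then show ?thesis
    unfolding T_star_def by (rule theI) (auto intro: crosses_one_at_unique \<open>crosses_one_at _ T\<close>)
qed

theorem proposition5p3:
  fixes \<beta> :: real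
  assumes "Overshoot_Hypothesis"
    and "\<beta> \<ge> 1"
  shows "(\<forall>w\<^sub>0. g \<beta> < w\<^sub>0 \<and> w\<^sub>0 < 1 \<longrightarrow>
            (\<forall>t. 0 \<le> t \<and> t < T_star \<beta> w\<^sub>0 \<longrightarrow> z_sol \<beta> w\<^sub>0 t < \<infinity>) \<and>
            (z_sol \<beta> w\<^sub>0 \<longlongrightarrow> \<infinity>) (at_left (T_star \<beta> w\<^sub>0)))
       \<and> (\<forall>w\<^sub>0. 0 < w\<^sub>0 \<and> w\<^sub>0 \<le> g \<beta> \<longrightarrow>
            (\<forall>t\<ge>0. z_sol \<beta> w\<^sub>0 t < \<infinity>) \<and>
            (z_sol \<beta> w\<^sub>0 \<longlongrightarrow> \<infinity>) at_top)
       \<and> (\<forall>w\<^sub>0 w\<^sub>1. 0 < w\<^sub>0 \<and> w\<^sub>0 < w\<^sub>1 \<and> w\<^sub>1 < 1 \<longrightarrow>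
            (\<forall>t>0. z_sol \<beta> w\<^sub>0 t < \<infinity> \<or> z_sol \<beta> w\<^sub>1 t < \<infinity> \<longrightarrow>
               z_sol \<beta> w\<^sub>0 t < z_sol \<beta> w\<^sub>1 t))
       \<and> (\<forall>\<beta>'>\<beta>. \<forall>t>0. z_sol \<beta> (g \<beta>) t < z_sol \<beta>' (g \<beta>') t)"
proof -
  have "0 < \<beta>" using \<open>\<beta> \<ge> 1\<close> by simp
  note thr = is_threshold_g[OF \<open>Overshoot_Hypothesis\<close>]
  have g: "0 < g b" "g b < 1" if "1 \<le> b" for b
    using thr[OF that] by (auto simp: is_threshold_def)
  have below: "u_sol b w t < 1" if "1 \<le> b" "0 < w" "w \<le> g b" "0 \<le> t" for b w t
    using thr[OF that(1)] that by (auto simp: is_threshold_def)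
  have overshoot: "(\<forall>t. 0 \<le> t \<and> t < T_star \<beta> w \<longrightarrow> z_sol \<beta> w t < \<infinity>) \<and>
      (z_sol \<beta> w \<longlongrightarrow> \<infinity>) (at_left (T_star \<beta> w))" if w: "g \<beta> < w" "w < 1" for w
  proof -
    have "0 < w" using g[OF \<open>\<beta> \<ge> 1\<close>] w by simp
    let ?T = "T_star \<beta> w"
    have cross: "0 < ?T" "\<And>t. 0 \<le> t \<Longrightarrow> t < ?T \<Longrightarrow> u_sol \<beta> w t < 1" "u_sol \<beta> w ?T = 1"
      using crosses_one_at_T_star[OF thr[OF \<open>\<beta> \<ge> 1\<close>] w] by (auto simp: crosses_one_at_def)
    have "isCont (u_sol \<beta> w) ?T"
      using continuous_on_interior[OF continuous_on_u_sol[OF \<open>0 < \<beta>\<close>]] cross(1)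
      by simp
    then have "(u_sol \<beta> w \<longlongrightarrow> 1) (at_left ?T)"
      using cross(3) by (auto simp: isCont_def intro: filterlim_mono at_le)
    moreover have "\<forall>\<^sub>F t in at_left ?T. 0 \<le> t \<and> u_sol \<beta> w t < 1"
      using eventually_at_left_real[OF cross(1)] by (rule eventually_mono) (use cross(2) in auto)
    ultimately show ?thesis
      using z_sol_tendsto_infinity z_sol_less_infinity_iff cross(2) \<open>0 < \<beta>\<close> \<open>0 < w\<close> \<open>w < 1\<close>
      by blast
  qed
  have no_overshoot: "(\<forall>t\<ge>0. z_sol \<beta> w t < \<infinity>) \<and> (z_sol \<beta> w \<longlongrightarrow> \<infinity>) at_top"
    if w: "0 < w" "w \<le> g \<beta>" for w
  proof -
    have "w < 1" using g[OF \<open>\<beta> \<ge> 1\<close>] w by simp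
    have "(u_sol \<beta> w \<longlongrightarrow> 1) at_top"
      using thr[OF \<open>\<beta> \<ge> 1\<close>] w by (auto simp: is_threshold_def)
    moreover have "\<forall>\<^sub>F t in at_top. 0 \<le> t \<and> u_sol \<beta> w t < 1"
      using eventually_ge_at_top[of 0]
      by (rule eventually_mono) (use below[OF \<open>\<beta> \<ge> 1\<close> w] in auto)
    ultimately show ?thesis
      using z_sol_tendsto_infinity z_sol_less_infinity_iff below[OF \<open>\<beta> \<ge> 1\<close> w]
        \<open>0 < \<beta>\<close> w(1) \<open>w < 1\<close>
      by blast
  qed
  have compare_w: "z_sol \<beta> w\<^sub>0 t < z_sol \<beta> w\<^sub>1 t"
    if w: "0 < w\<^sub>0" "w\<^sub>0 < w\<^sub>1" "w\<^sub>1 < 1" and t: "0 < t"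
      and fin: "z_sol \<beta> w\<^sub>0 t < \<infinity> \<or> z_sol \<beta> w\<^sub>1 t < \<infinity>" for w\<^sub>0 w\<^sub>1 t
  proof -
    have less: "u_sol \<beta> w\<^sub>0 t < u_sol \<beta> w\<^sub>1 t"
      using \<open>Overshoot_Hypothesis\<close> \<open>\<beta> \<ge> 1\<close> w t by (auto simp: Overshoot_Hypothesis_def)
    (* By this inequality, finiteness at the larger parameter forces it at the smaller one. *)
    moreover have "u_sol \<beta> w\<^sub>0 t < 1"
      using fin less z_sol_less_infinity_iff[of \<beta> w\<^sub>0 t] z_sol_less_infinity_iff[of \<beta> w\<^sub>1 t]
        \<open>0 < \<beta>\<close> w t
      by auto
    ultimately show ?thesis
      using \<open>0 < \<beta>\<close> w t by (intro z_sol_less) auto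
  qed
  have compare_threshold: "z_sol \<beta> (g \<beta>) t < z_sol \<beta>' (g \<beta>') t"
    if "\<beta> < \<beta>'" "0 < t" for \<beta>' t
  proof (rule z_sol_less)
    show "u_sol \<beta> (g \<beta>) t < u_sol \<beta>' (g \<beta>') t"
      using \<open>Overshoot_Hypothesis\<close> \<open>\<beta> \<ge> 1\<close> that by (auto simp: Overshoot_Hypothesis_def)
    show "u_sol \<beta> (g \<beta>) t < 1"
      using below[OF \<open>\<beta> \<ge> 1\<close>] g \<open>\<beta> \<ge> 1\<close> that by simp
  qed (use g \<open>\<beta> \<ge> 1\<close> that in auto)
  show ?thesis
    using overshoot no_overshoot compare_w compare_threshold by blast
qed

end
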